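(* Let $s_1,d_1,s_2,d_2$ be non-negative integers such that $\{s_1,d_1\}\neq\{s_2,d_2\}$ and $s_1+d_1=s_2+d_2\geq 2$. Then there exists a finite, non-empty set $A\subset\mathbb{Z}^2$, contained in an $n\times n$ integer lattice $\{0,1,\dots,n\}^2$ for some sufficiently large $n$, such that $$|s_1A-d_1A|>|s_2A-d_2A|.$$
   Context: For a finite set $A\subset\mathbb{Z}^2$ and non-negative integers $s,d$, define $sA-dA=\{x_1+\cdots+x_s-y_1-\cdots-y_d : x_i,y_j\in A\}$ (the $s$-fold sumset minus the $d$-fold sumset, with the empty sum equal to $0$). *)

theory Defs
  imports Main "HOL-Library.Product_Plus"
begin

definition sum_diff_set :: "nat \<Rightarrow> nat \<Rightarrow> 'a::ab_group_add set \<Rightarrow> 'a set" where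
  "sum_diff_set s d A =
     {(\<Sum>i<s. x i) - (\<Sum>j<d. y j) | x y. (\<forall>i<s. x i \<in> A) \<and> (\<forall>j<d. y j \<in> A)}"

(* Finiteness guarantees that card is the true cardinality (card of an infinite set is 0). *)
lemma finite_sum_diff_set:
  assumes "finite A"
  shows "finite (sum_diff_set s d A)"
proof -
  have fin: "finite {(\<Sum>i<m. x i) | x. \<forall>i<m. x i \<in> A}" (is "finite (?S m)") for m :: nat
  proof (induction m)
    case (Suc m)
    have "?S (Suc m) \<subseteq> (\<lambda>(u, v). u + v) ` (?S m \<times> A)"
      by force
    with Suc assms show ?case
      by (meson finite_SigmaI finite_imageI finite_subset)
  qed simp
  have "sum_diff_set s d A \<subseteq> (\<lambda>(u, v). u - v) ` (?S s \<times> ?S d)"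
    unfolding sum_diff_set_def by force
  with fin show ?thesis
    by (meson finite_SigmaI finite_imageI finite_subset)
qed

end

theory Submission
  imports Defs "HOL-Library.Set_Algebras"
begin

text \<open>
  Take \<open>A = P \<union> {T..N - T} \<union> (N - Q)\<close> in the integers, with \<open>P\<close>, \<open>Q\<close> small sets containing \<open>0\<close>,
  and with \<open>T\<close> and then \<open>N\<close> large. All differences between the cardinalities of the sets
  \<open>s A - d A\<close> with \<open>s + d = k\<close> come from the two ends: the left end of \<open>s A - d A\<close> is a copy of
  \<open>s P + d Q\<close>, the right end is a reflected copy of \<open>s Q + d P\<close>, and everything in between
  is present. With \<open>M = k + 1\<close>, the choice \<open>P = {0, 1}\<close>, \<open>Q = {0, M}\<close> gives \<open>2 (s + 1) (d + 1)\<close>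
  elements at the ends, which increases with \<open>s d\<close>; the choice \<open>P = {0, 1, M}\<close>, \<open>Q = {0}\<close> gives
  \<open>(s + 1) (s + 2) / 2 + (d + 1) (d + 2) / 2\<close> elements, which decreases with \<open>s d\<close>. Finally,
  \<open>s d\<close> and \<open>s + d\<close> determine \<open>{s, d}\<close>.
\<close>

section \<open>Iterated sumsets, and transfer from the line to the plane\<close>

definition sumset :: "nat \<Rightarrow> 'a::comm_monoid_add set \<Rightarrow> 'a set" where
  "sumset n A = (\<Sum>i<n. A)"

lemma sumset_0 [simp]: "sumset 0 A = {0}"
  by (simp add: sumset_def set_zero)

lemma sumset_Suc: "sumset (Suc n) A = sumset n A + A"
  by (simp add: sumset_def)

lemma sumset_eq: "sumset n A = {(\<Sum>i<n. x i) | x. \<forall>i<n. x i \<in> A}"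
  unfolding sumset_def by (subst set_sum_alt) auto

lemma sumset_add: "sumset (m + n) A = sumset m A + sumset n A"
  by (induction n) (simp_all add: sumset_Suc add.assoc flip: set_zero)

lemma sumset_mono: "A \<subseteq> B \<Longrightarrow> sumset n A \<subseteq> sumset n B"
  by (induction n) (simp_all add: sumset_Suc set_plus_mono2)

lemma finite_sumset: "finite A \<Longrightarrow> finite (sumset n A)"
  by (induction n) (simp_all add: sumset_Suc finite_set_plus)

lemma sum_diff_set_eq_image:
  "sum_diff_set s d A = (\<lambda>(u, v). u - v) ` (sumset s A \<times> sumset d A)"
  unfolding sum_diff_set_def sumset_eq by force

lemma sumset_image:
  assumes "f 0 = 0" and "\<And>x y. f (x + y) = f x + f y"
  shows "sumset n (f ` A) = f ` sumset n A"
proof (induction n)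
  case (Suc n)
  then show ?case
    by (force simp: sumset_Suc set_plus_def assms(2))
qed (simp add: assms(1))

text \<open>The embedding of the line into the plane as an axis is an injective homomorphism, so it
  suffices to construct a set of integers.\<close>

lemma card_sum_diff_set_times_zero:
  fixes A :: "'a::ab_group_add set"
  shows "card (sum_diff_set s d (A \<times> {0::'b::ab_group_add})) = card (sum_diff_set s d A)"
proof -
  let ?f = "\<lambda>x::'a. (x, 0::'b)"
  have "A \<times> {0} = ?f ` A"
    by auto
  then have sumset: "sumset n (A \<times> {0}) = ?f ` sumset n A" for n
    by (simp add: sumset_image zero_prod_def)
  have "sum_diff_set s d (A \<times> {0}) = ?f ` sum_diff_set s d A"
    unfolding sum_diff_set_eq_image sumset by (force simp: image_iff)
  then show ?thesis
    by (simp add: card_image inj_on_def)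
qed

section \<open>Integer sumsets: reflection, low parts and filled middles\<close>

lemma reflect_set_plus:
  fixes U V :: "int set"
  shows "(\<lambda>x. a + b - x) ` (U + V) = (\<lambda>x. a - x) ` U + (\<lambda>x. b - x) ` V"
  unfolding set_plus_image
  by (simp add: image_image image_paired_Times[symmetric] case_prod_beta algebra_simps)

lemma sumset_reflect:
  fixes A :: "int set"
  shows "sumset n ((\<lambda>x. N - x) ` A) = (\<lambda>x. int n * N - x) ` sumset n A"
proof (induction n)
  case (Suc n)
  then show ?case
    by (force simp: sumset_Suc set_plus_def algebra_simps)
qed simp

lemma sumset_bounds:
  fixes P :: "int set"
  assumes "P \<subseteq> {0..m}"
  shows "sumset n P \<subseteq> {0..int n * m}"
proof (induction n)
  case (Suc n)
  with assms show ?case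
    by (fastforce simp: sumset_Suc algebra_simps elim!: set_plus_elim)
qed simp

lemma sumset_nonneg:
  fixes A :: "int set"
  assumes "A \<subseteq> {0..}"
  shows "sumset n A \<subseteq> {0..}"
proof (induction n)
  case (Suc n)
  with assms show ?case
    by (fastforce simp: sumset_Suc elim!: set_plus_elim)
qed simp

text \<open>With nonnegative summands, a sum below \<open>T\<close> has every summand below
  \<open>T\<close>, hence in \<open>P\<close>.\<close>

lemma sumset_low_part:
  fixes A :: "int set"
  assumes "A \<subseteq> {0..}" "A \<inter> {..<T} \<subseteq> P" "x \<in> sumset n A" "x < T"
  shows "x \<in> sumset n P"
  using assms(3,4)
proof (induction n arbitrary: x)
  case (Suc n)
  then obtain u a where ua: "x = u + a" "u \<in> sumset n A" "a \<in> A"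
    by (auto simp: sumset_Suc elim!: set_plus_elim)
  have "0 \<le> u"
    using ua(2) sumset_nonneg[OF assms(1)] by auto
  with ua Suc.prems assms show ?case
    by (auto simp: sumset_Suc intro!: set_plus_intro Suc.IH)
qed simp

lemma sumset_middle:
  fixes N T :: int
  assumes "0 \<le> T" "3 * T \<le> N" "0 < k"
  shows "{T..int k * N - T} \<subseteq> sumset k ({0, N} \<union> {T..N - T})"
  using \<open>0 < k\<close>
proof (induction k rule: nat_induct_non_zero)
  case 1
  have "sumset 1 A = A" for A :: "int set"
    by (simp add: sumset_Suc flip: set_zero)
  then show ?case
    by auto
next
  case (Suc k)
  let ?C = "{0, N} \<union> {T..N - T}"
  have step: "u \<in> {T..int k * N - T} \<Longrightarrow> a \<in> ?C \<Longrightarrow> u + a \<in> sumset (Suc k) ?C" for u a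
    unfolding sumset_Suc using Suc.IH by (blast intro: set_plus_intro)
  have kN: "N \<le> int k * N"
    using assms Suc.hyps by (simp add: mult_le_cancel_right1)
  show ?case
  proof
    fix x
    assume x: "x \<in> {T..int (Suc k) * N - T}"
    \<comment> \<open>Adding \<open>0\<close> or \<open>N\<close> to the previous interval covers
      the first two cases. In the gap that may remain, fix \<open>T\<close> or \<open>2 * T\<close>
      in that interval and let the last summand run through \<open>{T..N - T}\<close>;
      \<open>3 * T \<le> N\<close> gives the room.\<close>
    consider "x \<le> int k * N - T" | "T + N \<le> x" | "int k * N - T < x" "x \<le> N"
      | "N < x" "x < T + N"
      by linarith
    then show "x \<in> sumset (Suc k) ?C"
    proof cases
      case 1
      with x step[of x 0] show ?thesis
        by simp
    next
      case 2
      with x step[of "x - N" N] show ?thesis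
        by (simp add: algebra_simps)
    next
      case 3
      with kN assms step[of T "x - T"] show ?thesis
        by simp
    next
      case 4
      moreover have "2 * T \<le> int k * N - T"
        using kN assms(2) by linarith
      ultimately have "x - 2 * T \<in> {T..N - T}" "2 * T \<in> {T..int k * N - T}"
        using assms by auto
      with step[of "2 * T" "x - 2 * T"] show ?thesis
        by simp
    qed
  qed
qed

section \<open>Sets with prescribed ends and a full middle\<close>

definition fringed :: "int \<Rightarrow> int \<Rightarrow> int set \<Rightarrow> int set \<Rightarrow> int set" where
  "fringed N T P Q = P \<union> {T..N - T} \<union> (\<lambda>x. N - x) ` Q"

lemma fringed_reflect: "(\<lambda>x. N - x) ` fringed N T P Q = fringed N T Q P"
  by (auto simp: fringed_def image_Un image_image)

lemma fringed_nonneg: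
  assumes "P \<subseteq> {0..<T}" "Q \<subseteq> {0..<T}" "0 \<le> T" "3 * T \<le> N"
  shows "fringed N T P Q \<subseteq> {0..}"
  using assms by (force simp: fringed_def)

lemma fringed_low_part:
  assumes "P \<subseteq> {0..<T}" "Q \<subseteq> {0..<T}" "0 \<le> T" "3 * T \<le> N"
  shows "fringed N T P Q \<inter> {..<T} \<subseteq> P"
  using assms by (force simp: fringed_def)

text \<open>Nonnegativity forces the summands of a small sum into \<open>P\<close> and
  \<open>Q\<close>; conversely \<open>(s + d) * m < T\<close> keeps all sums from \<open>P\<close>
  and \<open>Q\<close> below \<open>T\<close>.\<close>

lemma mixed_low_part:
  fixes P Q :: "int set"
  assumes "P \<subseteq> {0..m}" "Q \<subseteq> {0..m}" "int (s + d) * m < T" "m < T" "0 \<le> m" "3 * T \<le> N"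
  shows "(sumset s (fringed N T P Q) + sumset d (fringed N T Q P)) \<inter> {..<T}
    = sumset s P + sumset d Q"
proof (intro equalityI subsetI)
  have PQ: "P \<subseteq> {0..<T}" "Q \<subseteq> {0..<T}" "0 \<le> T"
    using assms by force+
  note nonneg = fringed_nonneg[OF PQ(1,2,3) assms(6)] fringed_nonneg[OF PQ(2,1,3) assms(6)]
  note low = fringed_low_part[OF PQ(1,2,3) assms(6)] fringed_low_part[OF PQ(2,1,3) assms(6)]
  fix x
  assume "x \<in> (sumset s (fringed N T P Q) + sumset d (fringed N T Q P)) \<inter> {..<T}"
  then obtain u v where uv: "x = u + v" "u \<in> sumset s (fringed N T P Q)"
      "v \<in> sumset d (fringed N T Q P)" "u + v < T"
    by (auto elim!: set_plus_elim)
  moreover have "0 \<le> u" "0 \<le> v"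
    using uv sumset_nonneg[OF nonneg(1)] sumset_nonneg[OF nonneg(2)] by auto
  ultimately show "x \<in> sumset s P + sumset d Q"
    using sumset_low_part[OF nonneg(1) low(1) uv(2)] sumset_low_part[OF nonneg(2) low(2) uv(3)]
    by auto
next
  fix x
  assume "x \<in> sumset s P + sumset d Q"
  then obtain u v where uv: "x = u + v" "u \<in> sumset s P" "v \<in> sumset d Q"
    by (auto elim!: set_plus_elim)
  then have "u \<le> int s * m" "v \<le> int d * m"
    using sumset_bounds[OF assms(1)] sumset_bounds[OF assms(2)] by force+
  then have "x < T"
    using uv assms(3) by (simp add: algebra_simps)
  moreover have "u \<in> sumset s (fringed N T P Q)" "v \<in> sumset d (fringed N T Q P)"
    using uv sumset_mono[of P "fringed N T P Q"] sumset_mono[of Q "fringed N T Q P"]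
    by (auto simp: fringed_def)
  ultimately show "x \<in> (sumset s (fringed N T P Q) + sumset d (fringed N T Q P)) \<inter> {..<T}"
    using uv by auto
qed

lemma card_sum_diff_set_fringed:
  fixes P Q :: "int set"
  assumes "P \<subseteq> {0..m}" "Q \<subseteq> {0..m}" "0 \<in> P" "0 \<in> Q" "0 \<le> m"
    and T: "int (s + d) * m < T" "m < T" and N: "3 * T \<le> N" and pos: "0 < s + d"
  shows "card (sum_diff_set s d (fringed N T P Q))
    = card (sumset s P + sumset d Q) + card (sumset s Q + sumset d P)
      + nat (int (s + d) * N - 2 * T + 1)"
proof -
  define K where "K = int (s + d) * N"
  \<comment> \<open>Subtracting \<open>a\<close> is adding \<open>N - a\<close> and shifting by
    \<open>-N\<close>. So \<open>X\<close>, which uses the reflected set in place of subtraction, is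
    a translate of the sum-difference set by \<open>d * N\<close>.\<close>
  define X where "X = sumset s (fringed N T P Q) + sumset d (fringed N T Q P)"
  have fin: "finite P" "finite Q"
    using assms(1,2) finite_subset by blast+
  then have "finite (fringed N T P Q)" "finite (fringed N T Q P)"
    by (auto simp: fringed_def)
  then have finX: "finite X"
    unfolding X_def by (intro finite_set_plus finite_sumset)
  have "N \<le> K"
    using pos N T assms(5) mult_right_mono[of 1 "int (s + d)" N] unfolding K_def by linarith
  have X_shift: "X = (\<lambda>x. int d * N + x) ` sum_diff_set s d (fringed N T P Q)"
    unfolding X_def sum_diff_set_eq_image fringed_reflect[of N T P Q, symmetric] sumset_reflect
    by (force simp: set_plus_def image_iff)
  \<comment> \<open>Reflection swaps \<open>P\<close> and \<open>Q\<close>, so the upper end of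
    \<open>X\<close> is again a low part.\<close>
  have X_reflect: "(\<lambda>x. K - x) ` X = sumset s (fringed N T Q P) + sumset d (fringed N T P Q)"
    by (simp add: X_def K_def distrib_right reflect_set_plus fringed_reflect
        flip: sumset_reflect)
  have low: "X \<inter> {..<T} = sumset s P + sumset d Q"
    unfolding X_def using assms by (intro mixed_low_part)
  have "(\<lambda>x. K - x) ` (X \<inter> {K - T<..}) = ((\<lambda>x. K - x) ` X) \<inter> {..<T}"
    by force
  also have "\<dots> = sumset s Q + sumset d P"
    unfolding X_reflect using assms by (intro mixed_low_part)
  finally have high: "card (X \<inter> {K - T<..}) = card (sumset s Q + sumset d P)"
    by (metis (no_types, lifting) card_image diff_left_imp_eq inj_onI)
  \<comment> \<open>This core lies in both the set and its reflection, so mixed sums contain its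
    \<open>(s + d)\<close>-fold sumset.\<close>
  let ?C = "{0, N} \<union> {T..N - T}"
  have "?C \<subseteq> fringed N T P Q" "?C \<subseteq> fringed N T Q P"
    using assms(3,4) by (force simp: fringed_def)+
  then have "sumset (s + d) ?C \<subseteq> X"
    unfolding X_def sumset_add by (intro set_plus_mono2 sumset_mono)
  moreover have "{T..K - T} \<subseteq> sumset (s + d) ?C"
    unfolding K_def using assms by (intro sumset_middle) auto
  ultimately have "X = (X \<inter> {..<T}) \<union> (X \<inter> {K - T<..}) \<union> {T..K - T}"
    by force
  moreover have "(X \<inter> {..<T}) \<inter> (X \<inter> {K - T<..}) = {}"
      "((X \<inter> {..<T}) \<union> (X \<inter> {K - T<..})) \<inter> {T..K - T} = {}"
    using \<open>N \<le> K\<close> N T assms(5) by force+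
  ultimately have "card X = card (X \<inter> {..<T}) + card (X \<inter> {K - T<..}) + card {T..K - T}"
    using finX by (metis card_Un_disjoint finite_Int finite_Un finite_atLeastAtMost_int)
  moreover have "card X = card (sum_diff_set s d (fringed N T P Q))"
    unfolding X_shift by (intro card_image) (simp add: inj_on_def)
  ultimately show ?thesis
    using low high by (simp add: K_def algebra_simps)
qed

text \<open>The middle contributes the same count for both pairs, as it depends only on
  \<open>s + d\<close>; only the ends need comparing.\<close>

lemma fringed_construction:
  fixes P Q :: "int set"
  assumes "P \<subseteq> {0..m}" "Q \<subseteq> {0..m}" "0 \<in> P" "0 \<in> Q" "0 \<le> m"
    and "s1 + d1 = s2 + d2" "0 < s2 + d2"
    and less: "card (sumset s2 P + sumset d2 Q) + card (sumset s2 Q + sumset d2 P)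
      < card (sumset s1 P + sumset d1 Q) + card (sumset s1 Q + sumset d1 P)"
  shows "\<exists>A :: (int \<times> int) set. finite A \<and> A \<noteq> {} \<and>
           (\<exists>n :: nat. A \<subseteq> {0..int n} \<times> {0..int n}) \<and>
           card (sum_diff_set s1 d1 A) > card (sum_diff_set s2 d2 A)"
proof -
  define T where "T = int (s2 + d2) * m + m + 1"
  define A where "A = fringed (3 * T) T P Q"
  have T: "int (s2 + d2) * m < T" "m < T"
    using \<open>0 \<le> m\<close> by (simp_all add: T_def add_nonneg_pos)
  have "finite A" "A \<noteq> {}"
    using assms(1-3) finite_subset by (auto simp: A_def fringed_def)
  moreover have "A \<subseteq> {0..int (nat (3 * T))}"
    using assms T by (force simp: A_def fringed_def)
  moreover have "card (sum_diff_set s2 d2 A) < card (sum_diff_set s1 d1 A)"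
    using assms T unfolding A_def by (simp add: card_sum_diff_set_fringed[where m = m])
  ultimately show ?thesis
    by (intro exI[of _ "A \<times> {0}"] conjI exI[of _ "nat (3 * T)"])
      (auto simp: card_sum_diff_set_times_zero)
qed

section \<open>Counting the ends by digits in base \<open>c\<close>\<close>

lemma sumset_pair: "sumset n {0, c :: int} = (\<lambda>i. c * int i) ` {..n}"
proof (induction n)
  case (Suc n)
  have "{..Suc n} = {..n} \<union> Suc ` {..n}"
    by (auto simp: image_iff le_Suc_eq)
  then have "(\<lambda>i. c * int i) ` {..Suc n} = (\<lambda>i. c * int i) ` {..n} \<union> (\<lambda>i. c * int i + c) ` {..n}"
    by (simp add: image_Un image_image algebra_simps)
  also have "\<dots> = sumset (Suc n) {0, c}"
    unfolding sumset_Suc Suc.IH by (force simp: set_plus_def)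
  finally show ?case
    by simp
qed simp

text \<open>Here \<open>i\<close> counts the summands \<open>1\<close> and \<open>j\<close> the
  summands \<open>c\<close>; the other \<open>n - i - j\<close> are \<open>0\<close>.\<close>

lemma sumset_triple:
  "sumset n {0, 1, c :: int} = (\<lambda>(i, j). int i + c * int j) ` (SIGMA i:{..n}. {..n - i})"
proof (induction n)
  case (Suc n)
  show ?case
  proof (intro equalityI subsetI)
    fix x
    assume "x \<in> sumset (Suc n) {0, 1, c}"
    then obtain i j a where "x = int i + c * int j + a" "a \<in> {0, 1, c}" "i \<le> n" "j \<le> n - i"
      unfolding sumset_Suc Suc.IH by (auto elim!: set_plus_elim)
    then consider "x = int i + c * int j" | "x = int (Suc i) + c * int j"
      | "x = int i + c * int (Suc j)"
      by (auto simp: algebra_simps)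
    then show "x \<in> (\<lambda>(i, j). int i + c * int j) ` (SIGMA i:{..Suc n}. {..Suc n - i})"
      using \<open>i \<le> n\<close> \<open>j \<le> n - i\<close>
      by cases (rule image_eqI[of _ _ "(i, j)"] image_eqI[of _ _ "(Suc i, j)"]
        image_eqI[of _ _ "(i, Suc j)"]; force)+
  next
    fix x
    assume "x \<in> (\<lambda>(i, j). int i + c * int j) ` (SIGMA i:{..Suc n}. {..Suc n - i})"
    then obtain i j where ij: "x = int i + c * int j" "i + j \<le> Suc n"
      by force
    have step: "int i + c * int j + a \<in> sumset (Suc n) {0, 1, c}"
      if "i + j \<le> n" "a \<in> {0, 1, c}" for i j a
      unfolding sumset_Suc Suc.IH using that by (intro set_plus_intro) force+
    \<comment> \<open>The last summand can be \<open>0\<close> if one is left over; otherwise split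
      off a \<open>1\<close> or a \<open>c\<close>.\<close>
    consider "i + j \<le> n" | i' where "i = Suc i'" | j' where "j = Suc j'"
      using ij(2) by (cases i; cases j) auto
    then show "x \<in> sumset (Suc n) {0, 1, c}"
    proof cases
      case 1
      with ij step[of i j 0] show ?thesis by simp
    next
      case 2
      with ij step[of i' j 1] show ?thesis by (simp add: algebra_simps)
    next
      case 3
      with ij step[of i j' c] show ?thesis by (simp add: algebra_simps)
    qed
  qed
qed simp

text \<open>The digit \<open>i\<close> is the remainder modulo \<open>c\<close>, and then
  \<open>j\<close> is determined.\<close>

lemma inj_on_digits:
  fixes c :: int
  assumes "int n < c"
  shows "inj_on (\<lambda>(i, j). int i + c * int j) ({..n} \<times> UNIV)"
proof (rule inj_onI, clarsimp)
  fix i j i' j' :: nat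
  assume le: "i \<le> n" "i' \<le> n" and eq: "int i + c * int j = int i' + c * int j'"
  have "(int i + c * int j) mod c = int i" "(int i' + c * int j') mod c = int i'"
    using le assms by simp_all
  with eq have "i = i'"
    by simp
  with eq assms show "i = i' \<and> j = j'"
    by simp
qed

lemma card_sumset_pairs:
  assumes "int s < c"
  shows "card (sumset s {0, 1} + sumset d {0, c}) = (s + 1) * (d + 1)"
proof -
  have "sumset s {0, 1} + sumset d {0, c} = (\<lambda>(i, j). int i + c * int j) ` ({..s} \<times> {..d})"
    unfolding sumset_pair by (force simp: set_plus_def)
  moreover have "inj_on (\<lambda>(i, j). int i + c * int j) ({..s} \<times> {..d})"
    using inj_on_digits[OF assms] by (rule inj_on_subset) auto
  ultimately show ?thesis
    by (simp add: card_image)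
qed

text \<open>The admissible digit pairs form a triangle; doubling avoids division.\<close>

lemma card_sumset_triple:
  assumes "int s < c"
  shows "2 * card (sumset s {0, 1, c}) = (s + 1) * (s + 2)"
proof -
  have "inj_on (\<lambda>(i, j). int i + c * int j) (SIGMA i:{..s}. {..s - i})"
    using inj_on_digits[OF assms] by (rule inj_on_subset) auto
  then have "card (sumset s {0, 1, c}) = (\<Sum>i\<le>s. Suc (s - i))"
    by (simp add: sumset_triple card_image)
  also have "\<dots> = (\<Sum>i\<le>s. Suc i)"
    by (rule sum.reindex_bij_witness[of _ "\<lambda>i. s - i" "\<lambda>i. s - i"]) auto
  finally have "card (sumset s {0, 1, c}) = (\<Sum>i\<le>s. Suc i)" .
  moreover have "2 * (\<Sum>i\<le>n. Suc i) = (n + 1) * (n + 2)" for n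
    by (induction n) auto
  ultimately show ?thesis
    by simp
qed

section \<open>Choosing the ends by comparing \<open>s1 * d1\<close> with
  \<open>s2 * d2\<close>\<close>

theorem theorem2p1:
  fixes s1 d1 s2 d2 :: nat
  assumes "{s1, d1} \<noteq> {s2, d2}"
    and "s1 + d1 = s2 + d2"
    and "s2 + d2 \<ge> 2"
  shows "\<exists>A :: (int \<times> int) set. finite A \<and> A \<noteq> {} \<and>
           (\<exists>n :: nat. A \<subseteq> {0..int n} \<times> {0..int n}) \<and>
           card (sum_diff_set s1 d1 A) > card (sum_diff_set s2 d2 A)"
proof -
  \<comment> \<open>Larger than all four parameters, so that digits in base \<open>c\<close> are
    unique; it also bounds both ends.\<close>
  define c where "c = int (s2 + d2) + 1"
  have c: "int s1 < c" "int d1 < c" "int s2 < c" "int d2 < c"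
    using assms(2) by (auto simp: c_def)
  have "s1 * d1 \<noteq> s2 * d2"
  proof
    assume "s1 * d1 = s2 * d2"
    then have eq: "int s1 * int d1 = int s2 * int d2"
      by (metis of_nat_mult)
    have d1: "int d1 = int s2 + int d2 - int s1"
      using assms(2) by linarith
    \<comment> \<open>Equal sum and product make \<open>s1\<close> a root of the quadratic with
      roots \<open>s2\<close> and \<open>d2\<close>.\<close>
    have "(int s1 - int s2) * (int s1 - int d2) = 0"
      using eq unfolding d1 by (simp add: algebra_simps)
    then have "s1 = s2 \<or> s1 = d2"
      by simp
    with assms(1,2) show False
      by auto
  qed
  then consider "s2 * d2 < s1 * d1" | "s1 * d1 < s2 * d2"
    by linarith
  then show ?thesis
  proof cases
    case 1
    \<comment> \<open>For fixed \<open>s + d\<close> the count grows with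
      \<open>s * d\<close>.\<close>
    have card: "card (sumset s {0, 1} + sumset d {0, c}) + card (sumset s {0, c} + sumset d {0, 1})
        = 2 * (s * d + (s + d) + 1)" if "int s < c" "int d < c" for s d
      using that by (simp add: card_sumset_pairs add.commute[of "sumset s {0, c}"])
    then show ?thesis
      using assms(2,3) 1 card[OF c(1,2)] card[OF c(3,4)]
      by (intro fringed_construction[of "{0, 1}" c "{0, c}"]) (auto simp: c_def)
  next
    case 2
    have zero: "sumset n {0} + B = B" "B + sumset n {0} = B" for n and B :: "int set"
    proof -
      have "sumset n {0 :: int} = 0"
        by (induction n) (simp_all add: sumset_Suc flip: set_zero)
      then show "sumset n {0} + B = B" "B + sumset n {0} = B"
        by simp_all
    qed
    define F where "F s d = card (sumset s {0, 1, c} + sumset d {0})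
      + card (sumset s {0} + sumset d {0, 1, c})" for s d
    \<comment> \<open>Since \<open>s^2 + d^2 = (s + d)^2 - 2 * s * d\<close>, the count now falls as
      \<open>s * d\<close> grows; the product stands on the left to avoid natural
      subtraction.\<close>
    have card: "2 * F s d + 2 * (s * d) = (s + d) * (s + d) + 3 * (s + d) + 4"
      if "int s < c" "int d < c" for s d
      using card_sumset_triple[OF that(1)] card_sumset_triple[OF that(2)]
      by (simp add: F_def zero algebra_simps)
    have "F s2 d2 < F s1 d1"
      using card[OF c(1,2)] card[OF c(3,4)] assms(2) 2 by simp
    then show ?thesis
      by (intro fringed_construction[of "{0, 1, c}" c "{0}"])
        (use assms(2,3) in \<open>auto simp: F_def c_def\<close>)
  qed
qed

end
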